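(* Let $G$ be a finite simple graph on vertex set $\{1,\dots,n\}$, $n\ge1$, with adjacency matrix $A^G$, let $\alpha(G)$ be the maximum cardinality of a stable (independent) set of $G$, and let $e_n=[1\ 1\ \cdots\ 1]^\top\in\mathbb{R}^n$. Then $$\alpha(G)=\max\big\{e_ne_n^\top\cdot X:\ (A^G+I_n)\cdot X=1,\ X\in C^{n*}\big\}$$ and $$\alpha(G)=\min\big\{t\in\mathbb{R}:\ t(A^G+I_n)-e_ne_n^\top\in C^n\big\},$$ and both programs reach this optimum value.
   Context: $M\cdot N=\sum_{i,j}M_{ij}N_{ij}$. $C^{n*}$ is the cone of completely positive matrices, i.e. the symmetric $X\in\mathbb{R}^{n\times n}$ that can be written $X=\sum_{i=1}^k y_iy_i^\top$ for some $k$ and vectors $y_i\in\mathbb{R}^n$ with $y_i\ge0$ componentwise. $C^n$ is the cone of copositive matrices, i.e. the symmetric $X\in\mathbb{R}^{n\times n}$ with $y^\top Xy\ge0$ for all $y\in\mathbb{R}^n$, $y\ge0$. *)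

theory Defs
  imports "HOL-Analysis.Analysis"
begin

text \<open>
  The vertex set \<open>{1,...,n}\<close> is the finite (hence nonempty) index type \<open>'n\<close>, so \<open>n = CARD('n)\<close>
  ranges over all \<open>n \<ge> 1\<close>, and a graph is given by its adjacency relation on \<open>'n\<close>.
  The all-ones vector is \<open>1 :: real ^ 'n\<close>, and the inner product \<open>\<bullet>\<close> of the type
  \<open>real ^ 'n ^ 'n\<close> is the trace inner product (lemma \<open>inner_matrix_eq_sum\<close>).
\<close>

lemma inner_matrix_eq_sum:
  fixes M N :: "real ^ 'n ^ 'n"
  shows "M \<bullet> N = (\<Sum>i\<in>UNIV. \<Sum>j\<in>UNIV. M $ i $ j * N $ i $ j)"
  by (simp add: inner_vec_def)

definition simple_graph :: "('n \<Rightarrow> 'n \<Rightarrow> bool) \<Rightarrow> bool" where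
  "simple_graph E \<longleftrightarrow> symp E \<and> irreflp E"

definition adjacency_matrix :: "('n::finite \<Rightarrow> 'n \<Rightarrow> bool) \<Rightarrow> real ^ 'n ^ 'n" where
  "adjacency_matrix E = (\<chi> i j. if E i j then 1 else 0)"

definition stable_set :: "('n \<Rightarrow> 'n \<Rightarrow> bool) \<Rightarrow> 'n set \<Rightarrow> bool" where
  "stable_set E S \<longleftrightarrow> (\<forall>i\<in>S. \<forall>j\<in>S. \<not> E i j)"

definition stability_number :: "('n::finite \<Rightarrow> 'n \<Rightarrow> bool) \<Rightarrow> nat" where
  "stability_number E = Max {card S | S. stable_set E S}"

definition outer_product :: "real ^ 'n \<Rightarrow> real ^ 'n \<Rightarrow> real ^ 'n ^ 'n" where
  "outer_product x y = (\<chi> i j. x $ i * y $ j)"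

definition completely_positive_cone :: "(real ^ 'n ^ 'n) set" where
  "completely_positive_cone =
     {X. transpose X = X \<and>
         (\<exists>(k::nat) (y :: nat \<Rightarrow> real ^ 'n).
            (\<forall>i\<in>{1..k}. \<forall>j. 0 \<le> y i $ j) \<and>
            X = (\<Sum>i=1..k. outer_product (y i) (y i)))}"

definition copositive_cone :: "(real ^ 'n ^ 'n) set" where
  "copositive_cone =
     {X. transpose X = X \<and>
         (\<forall>y :: real ^ 'n. (\<forall>j. 0 \<le> y $ j) \<longrightarrow> 0 \<le> y \<bullet> (X *v y))}"

text \<open>
  The library operators \<open>Max\<close> and \<open>Min\<close> are meaningful for finite sets only; the following
  predicates say that a value is the attained maximum or minimum of an arbitrary set of reals.
\<close>

definition is_maximum :: "real \<Rightarrow> real set \<Rightarrow> bool" where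
  "is_maximum v S \<longleftrightarrow> v \<in> S \<and> (\<forall>s\<in>S. s \<le> v)"

definition is_minimum :: "real \<Rightarrow> real set \<Rightarrow> bool" where
  "is_minimum v S \<longleftrightarrow> v \<in> S \<and> (\<forall>s\<in>S. v \<le> s)"

end

theory Submission
  imports Defs
begin

text \<open>
  Everything follows from the Motzkin--Straus inequality
  \<open>(\<Sum>i. y\<^sub>i)\<^sup>2 \<le> \<alpha>(G) y\<^sup>T (A + I) y\<close> for \<open>y \<ge> 0\<close>, together with the indicator vector of a maximum
  stable set, which attains equality. If the support of \<open>y\<close> is stable, the inequality is
  Cauchy--Schwarz. If the support contains an edge \<open>ij\<close>, the quadratic form is affine along
  \<open>e\<^sub>i - e\<^sub>j\<close>, because \<open>(e\<^sub>i - e\<^sub>j)\<^sup>T (A + I) (e\<^sub>i - e\<^sub>j) = 1 + 1 - 2 = 0\<close>; so one of the two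
  coordinates can be moved to the other without changing \<open>\<Sum>i. y\<^sub>i\<close> or increasing the form, which
  shrinks the support.
\<close>

text \<open>By linearity this turns the pairing of \<open>M\<close> with a completely positive
  matrix into a sum of values of the quadratic form of \<open>M\<close> at nonnegative
  vectors.\<close>

lemma inner_outer_product:
  fixes M :: "real ^ 'n::finite ^ 'n"
  shows "M \<bullet> outer_product y y = y \<bullet> (M *v y)"
  unfolding inner_matrix_eq_sum
  by (simp add: outer_product_def inner_vec_def matrix_vector_mult_def sum_distrib_left mult_ac)

lemma quadratic_form_outer_product_one:
  fixes y :: "real ^ 'n::finite"
  shows "y \<bullet> (outer_product 1 1 *v y) = (\<Sum>i\<in>UNIV. y $ i)\<^sup>2"
  by (simp add: outer_product_def inner_vec_def matrix_vector_mult_def power2_eq_square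
      sum_distrib_right)

lemma quadratic_form_adjacency_plus_id:
  fixes y :: "real ^ 'n::finite"
  shows "y \<bullet> ((adjacency_matrix E + mat 1) *v y) =
    (\<Sum>i\<in>UNIV. \<Sum>j\<in>UNIV. if E i j then y $ i * y $ j else 0) + (\<Sum>i\<in>UNIV. (y $ i)\<^sup>2)"
proof -
  have "y \<bullet> (adjacency_matrix E *v y) =
      (\<Sum>i\<in>UNIV. \<Sum>j\<in>UNIV. if E i j then y $ i * y $ j else 0)"
    by (auto simp: inner_vec_def matrix_vector_mult_def adjacency_matrix_def sum_distrib_left
        intro!: sum.cong)
  moreover have "y \<bullet> y = (\<Sum>i\<in>UNIV. (y $ i)\<^sup>2)"
    by (simp add: inner_vec_def power2_eq_square)
  ultimately show ?thesis
    by (simp add: matrix_vector_mult_add_rdistrib inner_add_right)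
qed

text \<open>No edge joins two support vertices, so every product in the adjacency part has a zero
  factor.\<close>

lemma quadratic_form_of_stable_support:
  fixes y :: "real ^ 'n::finite"
  assumes "stable_set E {i. y $ i \<noteq> 0}"
  shows "y \<bullet> ((adjacency_matrix E + mat 1) *v y) = (\<Sum>i\<in>UNIV. (y $ i)\<^sup>2)"
proof -
  have "(\<Sum>i\<in>UNIV. \<Sum>j\<in>UNIV. if E i j then y $ i * y $ j else 0) = 0"
    using assms unfolding stable_set_def by (intro sum.neutral ballI) auto
  then show ?thesis
    by (simp add: quadratic_form_adjacency_plus_id)
qed

lemma transpose_adjacency_plus_id:
  assumes "simple_graph E"
  shows "transpose (adjacency_matrix E + mat 1) = adjacency_matrix E + mat 1"
  using assms unfolding simple_graph_def
  by (auto simp: transpose_def adjacency_matrix_def mat_def vec_eq_iff dest: sympD)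

lemma card_le_stability_number:
  fixes E :: "'n::finite \<Rightarrow> 'n \<Rightarrow> bool"
  assumes "stable_set E S"
  shows "card S \<le> stability_number E"
  unfolding stability_number_def using assms by (intro Max_ge) auto

lemma maximum_stable_set_exists:
  fixes E :: "'n::finite \<Rightarrow> 'n \<Rightarrow> bool"
  obtains S where "stable_set E S" "card S = stability_number E"
proof -
  have "stable_set E {}"
    by (simp add: stable_set_def)
  then have "Max {card S | S. stable_set E S} \<in> {card S | S. stable_set E S}"
    by (intro Max_in) auto
  then show ?thesis
    using that unfolding stability_number_def by auto
qed

lemma stability_number_pos:
  fixes E :: "'n::finite \<Rightarrow> 'n \<Rightarrow> bool"
  assumes "simple_graph E"
  shows "0 < stability_number E"
proof -
  \<comment> \<open>\<open>undefined\<close> serves as an arbitrary vertex: the index type is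
    nonempty, and a single vertex is stable because there are no loops.\<close>
  have "stable_set E {undefined}"
    using assms by (auto simp: stable_set_def simple_graph_def dest: irreflpD)
  from card_le_stability_number[OF this] show ?thesis
    by simp
qed

text \<open>The sign of the linear coefficient tells in which direction mass can move along the edge
  without increasing the form.\<close>

lemma quadratic_form_shift_along_edge:
  fixes E :: "'n::finite \<Rightarrow> 'n \<Rightarrow> bool" and y :: "real ^ 'n"
  defines "B \<equiv> adjacency_matrix E + mat 1"
  assumes G: "simple_graph E" and e: "E i j"
  shows "(y + c *\<^sub>R (axis i 1 - axis j 1)) \<bullet> (B *v (y + c *\<^sub>R (axis i 1 - axis j 1))) =
    y \<bullet> (B *v y) + 2 * c * ((B *v y) $ i - (B *v y) $ j)"
proof -
  define d :: "real ^ 'n" where "d = axis i 1 - axis j 1"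
  \<comment> \<open>Symmetry of \<open>B\<close> makes the two cross terms of the expansion equal,
    whence the factor 2.\<close>
  have sym: "x \<bullet> (B *v z) = z \<bullet> (B *v x)" for x z
    using transpose_adjacency_plus_id[OF G] dot_lmul_matrix[of x B z]
    unfolding B_def by (metis inner_commute transpose_matrix_vector)
  have d_inner: "d \<bullet> v = v $ i - v $ j" for v
    by (simp add: d_def inner_diff_left inner_axis')
  have "(B *v d) $ k = B $ k $ i - B $ k $ j" for k
    by (simp add: d_def matrix_vector_mult_diff_distrib matrix_vector_mul_component inner_axis)
  \<comment> \<open>These facts say that the four entries of \<open>B\<close> with indices in {i, j}
    all equal 1, so the quadratic term in \<open>c\<close> cancels.\<close>
  moreover have "E j i" "\<not> E i i" "\<not> E j j" "i \<noteq> j"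
    using G e unfolding simple_graph_def by (auto dest: sympD irreflpD)
  ultimately have "d \<bullet> (B *v d) = 0"
    using e by (simp add: d_inner B_def adjacency_matrix_def mat_def)
  then have "(y + c *\<^sub>R d) \<bullet> (B *v (y + c *\<^sub>R d)) = y \<bullet> (B *v y) + 2 * c * (d \<bullet> (B *v y))"
    using sym[of y d]
    by (simp add: matrix_vector_right_distrib matrix_vector_mult_scaleR inner_add_left
        inner_add_right)
  then show ?thesis
    by (simp add: d_inner flip: d_def)
qed

theorem Motzkin_Straus:
  fixes E :: "'n::finite \<Rightarrow> 'n \<Rightarrow> bool" and y :: "real ^ 'n"
  assumes G: "simple_graph E" and "\<And>i. 0 \<le> y $ i"
  shows "(\<Sum>i\<in>UNIV. y $ i)\<^sup>2 \<le>
    real (stability_number E) * (y \<bullet> ((adjacency_matrix E + mat 1) *v y))"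
  using assms(2)
proof (induction "card {i. y $ i \<noteq> 0}" arbitrary: y rule: less_induct)
  case less
  define B where "B = (adjacency_matrix E + mat 1 :: real ^ 'n ^ 'n)"
  let ?S = "{i. y $ i \<noteq> 0}"
  show ?case
  proof (cases "stable_set E ?S")
    case True
    \<comment> \<open>Restricting to the support before applying Cauchy-Schwarz with the constant 1
      gives the factor \<open>card ?S\<close> instead of the number of all vertices.\<close>
    have "(\<Sum>i\<in>UNIV. y $ i)\<^sup>2 = (\<Sum>i\<in>?S. 1 * y $ i)\<^sup>2"
      by (intro arg_cong[where f = "\<lambda>x. x\<^sup>2"] sum.mono_neutral_cong_right) auto
    also have "\<dots> \<le> (\<Sum>i\<in>?S. 1\<^sup>2) * (\<Sum>i\<in>?S. (y $ i)\<^sup>2)"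
      by (rule Cauchy_Schwarz_ineq_sum)
    also have "\<dots> = real (card ?S) * (\<Sum>i\<in>UNIV. (y $ i)\<^sup>2)"
      by (simp, intro disjI2 sum.mono_neutral_left) auto
    also have "\<dots> \<le> real (stability_number E) * (\<Sum>i\<in>UNIV. (y $ i)\<^sup>2)"
      using card_le_stability_number[OF True] by (intro mult_right_mono sum_nonneg) auto
    finally show ?thesis
      using quadratic_form_of_stable_support[OF True] by simp
  next
    case False
    then obtain a b where ab: "y $ a \<noteq> 0" "y $ b \<noteq> 0" "E a b"
      unfolding stable_set_def by blast
    then have "E b a"
      using G unfolding simple_graph_def by (auto dest: sympD)
    \<comment> \<open>The edge is oriented so that moving mass from \<open>j\<close> to
      \<open>i\<close> has a nonpositive linear coefficient.\<close>
    then obtain i j where ij: "y $ i \<noteq> 0" "y $ j \<noteq> 0" "E i j" "(B *v y) $ i \<le> (B *v y) $ j"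
      using ab by (meson linear)
    then have "i \<noteq> j"
      using G unfolding simple_graph_def by (auto dest: irreflpD)
    \<comment> \<open>The step length \<open>y $ j\<close> empties vertex \<open>j\<close> exactly;
      \<open>i\<close> already lies in the support, so no new vertex enters it.\<close>
    define z where "z = y + (y $ j) *\<^sub>R (axis i 1 - axis j 1)"
    have z: "z $ k = (if k = i then y $ i + y $ j else if k = j then 0 else y $ k)" for k
      using \<open>i \<noteq> j\<close> by (auto simp: z_def axis_def)
    have "z $ k = 0" if "y $ k = 0" for k
      using that ij(1) by (auto simp: z)
    moreover have "z $ j = 0"
      using \<open>i \<noteq> j\<close> by (simp add: z)
    ultimately have "{k. z $ k \<noteq> 0} \<subset> ?S"
      using ij(2) by blast
    then have "card {k. z $ k \<noteq> 0} < card ?S"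
      by (simp add: psubset_card_mono)
    moreover have "0 \<le> z $ k" for k
      using less.prems by (simp add: z)
    ultimately have "(\<Sum>k\<in>UNIV. z $ k)\<^sup>2 \<le> real (stability_number E) * (z \<bullet> (B *v z))"
      unfolding B_def by (rule less.hyps)
    moreover have "(\<Sum>k\<in>UNIV. z $ k) = (\<Sum>k\<in>UNIV. y $ k)"
      by (simp add: z_def sum.distrib sum_subtractf axis_def sum_distrib_left[symmetric])
    moreover have "z \<bullet> (B *v z) \<le> y \<bullet> (B *v y)"
      using quadratic_form_shift_along_edge[OF G ij(3), of y "y $ j"] ij(4) less.prems[of j]
      by (simp add: z_def B_def mult_nonneg_nonpos)
    ultimately show ?thesis
      unfolding B_def by (smt (verit) mult_left_mono of_nat_0_le_iff)
  qed
qed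

text \<open>The scale \<open>c\<close> is left free because the two programs need different
  normalizations of the same vector.\<close>

lemma indicator_vector_of_stable_set:
  fixes E :: "'n::finite \<Rightarrow> 'n \<Rightarrow> bool" and S :: "'n set" and c :: real
  assumes "stable_set E S"
  defines "y \<equiv> (\<chi> i. if i \<in> S then c else 0) :: real ^ 'n"
  shows "(\<Sum>i\<in>UNIV. y $ i) = real (card S) * c"
    and "y \<bullet> ((adjacency_matrix E + mat 1) *v y) = real (card S) * c\<^sup>2"
proof -
  show "(\<Sum>i\<in>UNIV. y $ i) = real (card S) * c"
    by (simp add: y_def flip: sum.inter_filter)
  have "stable_set E {i. y $ i \<noteq> 0}"
    using assms(1) by (auto simp: y_def stable_set_def)
  moreover have "(\<Sum>i\<in>UNIV. (y $ i)\<^sup>2) = (\<Sum>i\<in>UNIV. if i \<in> S then c\<^sup>2 else 0)"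
    by (intro sum.cong) (auto simp: y_def)
  ultimately show "y \<bullet> ((adjacency_matrix E + mat 1) *v y) = real (card S) * c\<^sup>2"
    by (simp add: quadratic_form_of_stable_support flip: sum.inter_filter)
qed

theorem mainTheorem15:
  fixes E :: "'n::finite \<Rightarrow> 'n \<Rightarrow> bool"
  assumes "simple_graph E"
  shows "is_maximum (real (stability_number E))
           {outer_product 1 1 \<bullet> X | X :: real ^ 'n ^ 'n.
              (adjacency_matrix E + mat 1) \<bullet> X = 1 \<and> X \<in> completely_positive_cone}
       \<and> is_minimum (real (stability_number E))
           {t :: real. t *\<^sub>R (adjacency_matrix E + mat 1) - outer_product 1 1 \<in> copositive_cone}"
proof -
  define B where "B = (adjacency_matrix E + mat 1 :: real ^ 'n ^ 'n)"
  define a where "a = real (stability_number E)"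
  have a: "0 < a"
    using stability_number_pos[OF assms] by (simp add: a_def)
  have MS: "(\<Sum>i\<in>UNIV. y $ i)\<^sup>2 \<le> a * (y \<bullet> (B *v y))" if "\<And>i. 0 \<le> y $ i" for y :: "real ^ 'n"
    using Motzkin_Straus[OF assms that] by (simp add: a_def B_def)
  have form_diff: "y \<bullet> ((t *\<^sub>R B - outer_product 1 1) *v y) =
      t * (y \<bullet> (B *v y)) - (\<Sum>i\<in>UNIV. y $ i)\<^sup>2" for t and y :: "real ^ 'n"
    by (simp add: matrix_vector_mult_diff_rdistrib inner_diff_right
        quadratic_form_outer_product_one flip: scaleR_matrix_vector_assoc)
  obtain S where S: "stable_set E S" and "card S = stability_number E"
    by (rule maximum_stable_set_exists)
  then have card_S: "real (card S) = a"
    by (simp add: a_def)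
  define y :: "real \<Rightarrow> real ^ 'n" where "y c = (\<chi> i. if i \<in> S then c else 0)" for c
  have sum_y: "(\<Sum>i\<in>UNIV. y c $ i) = a * c" and form_y: "y c \<bullet> (B *v y c) = a * c\<^sup>2" for c
    using indicator_vector_of_stable_set[OF S, of c] by (simp_all add: y_def B_def card_S)

  have "is_maximum a {outer_product 1 1 \<bullet> X | X. B \<bullet> X = 1 \<and> X \<in> completely_positive_cone}"
    unfolding is_maximum_def
  proof (intro conjI ballI)
    \<comment> \<open>The constraint on the rank-one matrix reads \<open>a * c\<^sup>2 = 1\<close>;
      the objective \<open>(a * c)\<^sup>2\<close> then equals \<open>a\<close>.\<close>
    define c where "c = 1 / sqrt a"
    have c: "c\<^sup>2 = 1 / a" "0 \<le> c"
      using a by (simp_all add: c_def power_divide)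
    define X where "X = outer_product (y c) (y c)"
    have "transpose X = X"
      by (simp add: X_def outer_product_def transpose_def vec_eq_iff)
    moreover have "X = (\<Sum>i=1..1::nat. outer_product (y c) (y c))"
      by (simp add: X_def)
    moreover have "\<forall>j. 0 \<le> y c $ j"
      using c by (simp add: y_def)
    ultimately have "X \<in> completely_positive_cone"
      unfolding completely_positive_cone_def mem_Collect_eq
      by (intro conjI exI[of _ 1] exI[of _ "\<lambda>_. y c"]) auto
    moreover have "B \<bullet> X = 1"
      using a by (simp add: X_def inner_outer_product form_y c)
    moreover have "outer_product 1 1 \<bullet> X = a"
      using a by (simp add: X_def inner_outer_product quadratic_form_outer_product_one sum_y c
          power_mult_distrib power2_eq_square[of a])
    ultimately show "a \<in> {outer_product 1 1 \<bullet> X | X. B \<bullet> X = 1 \<and> X \<in> completely_positive_cone}"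
      by force
  next
    fix s
    assume "s \<in> {outer_product 1 1 \<bullet> X | X. B \<bullet> X = 1 \<and> X \<in> completely_positive_cone}"
    then obtain k :: nat and v :: "nat \<Rightarrow> real ^ 'n"
      where v: "\<And>i j. i \<in> {1..k} \<Longrightarrow> 0 \<le> v i $ j"
        and BX: "B \<bullet> (\<Sum>i=1..k. outer_product (v i) (v i)) = 1"
        and s: "s = outer_product 1 1 \<bullet> (\<Sum>i=1..k. outer_product (v i) (v i))"
      unfolding completely_positive_cone_def by blast
    have "s = (\<Sum>i=1..k. (\<Sum>j\<in>UNIV. v i $ j)\<^sup>2)"
      by (simp add: s inner_sum_right inner_outer_product quadratic_form_outer_product_one)
    \<comment> \<open>Motzkin-Straus is applied to each generator; the forms then add up to
      \<open>B \<bullet> X = 1\<close>.\<close>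
    also have "\<dots> \<le> (\<Sum>i=1..k. a * (v i \<bullet> (B *v v i)))"
      using v by (intro sum_mono MS) auto
    also have "\<dots> = a"
      using BX by (simp add: inner_sum_right inner_outer_product flip: sum_distrib_left)
    finally show "s \<le> a" .
  qed
  moreover have "is_minimum a {t. t *\<^sub>R B - outer_product 1 1 \<in> copositive_cone}"
    unfolding is_minimum_def
  proof (intro conjI ballI)
    have "transpose B = B"
      using transpose_adjacency_plus_id[OF assms] by (simp add: B_def)
    then have "transpose (a *\<^sub>R B - outer_product 1 1) = a *\<^sub>R B - outer_product 1 1"
      by (simp add: transpose_def outer_product_def vec_eq_iff)
    \<comment> \<open>Given symmetry, copositivity of this matrix is Motzkin-Straus itself.\<close>
    then show "a \<in> {t. t *\<^sub>R B - outer_product 1 1 \<in> copositive_cone}"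
      using MS by (simp add: copositive_cone_def form_diff)
  next
    fix t
    assume "t \<in> {t. t *\<^sub>R B - outer_product 1 1 \<in> copositive_cone}"
    moreover have "\<forall>j. 0 \<le> y 1 $ j"
      by (simp add: y_def)
    \<comment> \<open>Testing copositivity on the indicator vector of a maximum stable set gives
      \<open>t * a - a\<^sup>2 \<ge> 0\<close>, and \<open>a > 0\<close> cancels.\<close>
    ultimately have "0 \<le> y 1 \<bullet> ((t *\<^sub>R B - outer_product 1 1) *v y 1)"
      unfolding copositive_cone_def by blast
    then have "a * a \<le> t * a"
      by (simp add: form_diff form_y sum_y power2_eq_square)
    then show "a \<le> t"
      using a by simp
  qed
  ultimately show ?thesis
    by (simp add: a_def B_def)
qed

end
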